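(* Every graph in $\varepsilon_{12}$ is planar.
   Context: All graphs are finite, simple and connected. An Euler graph is a connected graph all of whose nodes have even degree. $\varepsilon_{12}$ is the class of Euler graphs in which every cycle has length $\equiv 1$ or $\equiv 2\pmod 4$ and which contain at least one cycle of each of these two kinds. *)

theory Defs
  imports "HOL-Analysis.Analysis" "Graph_Theory.Graph_Theory"
begin

text \<open>Finite simple graphs are the symmetric loop-free digraphs \<^const>\<open>pair_graph\<close>: an
  undirected edge \<open>uv\<close> is the pair of arcs \<open>(u,v)\<close>, \<open>(v,u)\<close>, so the degree of a vertex is its
  \<^const>\<open>out_degree\<close>.\<close>

definition Euler_graph :: "'a pair_pre_digraph \<Rightarrow> bool" where
  "Euler_graph G \<longleftrightarrow>
     pair_graph G \<and> Digraph_Component.connected (with_proj G) \<and>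
     (\<forall>v \<in> pverts G. even (out_degree (with_proj G) v))"

text \<open>The bound on the length excludes the directed cycles \<open>[(u,v), (v,u)]\<close>, which traverse one
  undirected edge back and forth.\<close>

definition undirected_cycle :: "'a pair_pre_digraph \<Rightarrow> ('a \<times> 'a) list \<Rightarrow> bool" where
  "undirected_cycle G p \<longleftrightarrow> pre_digraph.cycle (with_proj G) p \<and> 3 \<le> length p"

definition eps12 :: "'a pair_pre_digraph set" where
  "eps12 = {G. Euler_graph G \<and>
     (\<forall>p. undirected_cycle G p \<longrightarrow> length p mod 4 = 1 \<or> length p mod 4 = 2) \<and>
     (\<exists>p. undirected_cycle G p \<and> length p mod 4 = 1) \<and>
     (\<exists>p. undirected_cycle G p \<and> length p mod 4 = 2)}"

text \<open>The curves are indexed by the undirected edges \<open>{u,v}\<close>, so that the two arcs of an edge share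
  one (unoriented) curve.\<close>

definition plane_embedding ::
  "'a pair_pre_digraph \<Rightarrow> ('a \<Rightarrow> real^2) \<Rightarrow> ('a set \<Rightarrow> real \<Rightarrow> real^2) \<Rightarrow> bool" where
  "plane_embedding G \<phi> \<gamma> \<longleftrightarrow>
     inj_on \<phi> (pverts G) \<and>
     (\<forall>(u,v) \<in> parcs G.
        arc (\<gamma> {u,v}) \<and>
        {pathstart (\<gamma> {u,v}), pathfinish (\<gamma> {u,v})} = {\<phi> u, \<phi> v} \<and>
        path_image (\<gamma> {u,v}) \<inter> \<phi> ` pverts G = {\<phi> u, \<phi> v}) \<and>
     (\<forall>(u,v) \<in> parcs G. \<forall>(x,y) \<in> parcs G. {u,v} \<noteq> {x,y} \<longrightarrow>
        path_image (\<gamma> {u,v}) \<inter> path_image (\<gamma> {x,y}) \<subseteq> \<phi> ` ({u,v} \<inter> {x,y}))"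

definition planar :: "'a pair_pre_digraph \<Rightarrow> bool" where
  "planar G \<longleftrightarrow> (\<exists>\<phi> \<gamma>. plane_embedding G \<phi> \<gamma>)"

end

theory Submission
  imports Defs
begin

text \<open>If the three cycles of a theta graph have lengths \<open>\<equiv> 1, 2 (mod 4)\<close>, then at most one of its
  three paths has even length, and this cannot hold for all six theta graphs inside a subdivided
  \<open>K\<^sub>4\<close>. A graph of minimum degree at least three contains a subdivided \<open>K\<^sub>4\<close>, found on a longest
  path. Hence some vertex has degree at most two. Suppressing it, and giving the new edge the sum
  of the two old lengths, preserves the condition on cycles, so the graph is a subgraph of a 2-tree.
  A 2-tree is drawn with straight lines by putting each new vertex close to the midpoint of the edge
  it is attached to.\<close>

section \<open>Walks and cycles\<close>

definition walk_edges :: "'a list \<Rightarrow> 'a set list" where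
  "walk_edges xs = map (\<lambda>(x, y). {x, y}) (vwalk_arcs xs)"

lemma walk_edges_simps [simp]:
  "walk_edges [] = []"
  "walk_edges [x] = []"
  "walk_edges (x # y # xs) = {x, y} # walk_edges (y # xs)"
  by (simp_all add: walk_edges_def)

lemma walk_edges_append:
  assumes "xs \<noteq> []" "ys \<noteq> []"
  shows "walk_edges (xs @ ys) = walk_edges xs @ {last xs, hd ys} # walk_edges ys"
  using assms by (simp add: walk_edges_def vwalk_arcs_append)

lemma walk_edges_append_Cons:
  "walk_edges (xs @ y # ys) = walk_edges (xs @ [y]) @ walk_edges (y # ys)"
  by (induction xs rule: induct_list012) auto

lemma walk_edges_rev: "walk_edges (rev xs) = rev (walk_edges xs)"
proof (induction xs rule: induct_list012)
  case (3 x y zs)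
  then show ?case
    using walk_edges_append_Cons[of "rev zs" y "[x]"] by (simp add: insert_commute)
qed simp_all

lemma walk_edges_subset: "e \<in> set (walk_edges xs) \<Longrightarrow> e \<subseteq> set xs"
  by (induction xs rule: induct_list012) auto

lemma Union_walk_edges: "2 \<le> length xs \<Longrightarrow> \<Union> (set (walk_edges xs)) = set xs"
proof (induction xs rule: induct_list012)
  case (3 x y zs)
  then show ?case by (cases zs) auto
qed simp_all

lemma in_walk_edgesE:
  assumes "e \<in> set (walk_edges xs)"
  obtains us x y vs where "xs = us @ x # y # vs" "e = {x, y}"
  using assms
proof (induction xs arbitrary: thesis rule: induct_list012)
  case (3 x y zs)
  show ?case
  proof (cases "e = {x, y}")
    case True
    then show ?thesis
      using "3.prems"(1)[of "[]"] by simp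
  next
    case False
    with "3.prems"(2) have "e \<in> set (walk_edges (y # zs))" by simp
    then obtain us x' y' vs where "y # zs = us @ x' # y' # vs" "e = {x', y'}"
      using "3.IH"(2) by blast
    then show ?thesis
      using "3.prems"(1)[of "x # us"] by simp
  qed
qed simp_all

lemma distinct_walk_edges: "distinct xs \<Longrightarrow> distinct (walk_edges xs)"
proof (induction xs rule: induct_list012)
  case (3 x y zs)
  then show ?case
    using walk_edges_subset[of "{x, y}" "y # zs"] by auto
qed simp_all

definition cycle_edges :: "'a list \<Rightarrow> 'a set list" where
  "cycle_edges xs = walk_edges (xs @ [hd xs])"

lemma distinct_cycle_edges:
  assumes "distinct xs" "3 \<le> length xs"
  shows "distinct (cycle_edges xs)"
proof -
  obtain x y z zs where xs: "xs = x # y # z # zs"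
    using assms(2) by (auto simp: numeral_3_eq_3 Suc_le_length_iff)
  have "distinct (walk_edges (y # z # zs @ [x]))"
    by (rule distinct_walk_edges) (use assms(1) xs in auto)
  moreover have "{x, y} \<notin> set (walk_edges (z # zs @ [x]))"
    using walk_edges_subset[of "{x, y}" "z # zs @ [x]"] assms(1) xs by auto
  ultimately show ?thesis
    using assms(1) xs by (auto simp: cycle_edges_def doubleton_eq_iff)
qed

lemma cycle_edges_subdivide:
  assumes "e \<in> set (cycle_edges xs)"
  obtains ys zs x y E E' where "xs = ys @ zs" "e = {x, y}" "cycle_edges xs = E @ {x, y} # E'"
    "\<And>v. cycle_edges (ys @ v # zs) = E @ {x, v} # {v, y} # E'"
proof -
  from assms obtain us x y vs where split: "xs @ [hd xs] = us @ x # y # vs" "e = {x, y}"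
    unfolding cycle_edges_def by (rule in_walk_edgesE)
  define zs where "zs = butlast (y # vs)"
  have closing: "y # vs = zs @ [hd xs]"
    using arg_cong[OF split(1), of last] by (simp add: zs_def append_butlast_last_id)
  then have xs: "xs = (us @ [x]) @ zs"
    using split(1) by auto
  then have "hd ((us @ [x]) @ v # zs) = hd xs" for v
    by (cases us) auto
  then have "cycle_edges ((us @ [x]) @ v # zs) =
      walk_edges (us @ [x]) @ {x, v} # {v, y} # walk_edges (y # vs)" for v
    using walk_edges_append_Cons[of us x "v # y # vs"]
    by (simp add: cycle_edges_def flip: closing)
  moreover have "cycle_edges xs = walk_edges (us @ [x]) @ {x, y} # walk_edges (y # vs)"
    using split(1) walk_edges_append_Cons[of us x "y # vs"] by (simp add: cycle_edges_def)
  ultimately show ?thesis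
    using that xs split(2) by blast
qed

definition vertex_cycle :: "'a set set \<Rightarrow> 'a list \<Rightarrow> bool" where
  "vertex_cycle F xs \<longleftrightarrow> 3 \<le> length xs \<and> distinct xs \<and> set (cycle_edges xs) \<subseteq> F"

definition cycle_weight :: "('a set \<Rightarrow> 'b::comm_monoid_add) \<Rightarrow> 'a list \<Rightarrow> 'b" where
  "cycle_weight w xs = (\<Sum>e\<leftarrow>cycle_edges xs. w e)"

lemma vertex_cycle_mono: "vertex_cycle F xs \<Longrightarrow> F \<subseteq> F' \<Longrightarrow> vertex_cycle F' xs"
  by (auto simp: vertex_cycle_def)

lemma vertex_cycle_subset_Union:
  assumes "vertex_cycle F xs"
  shows "set xs \<subseteq> \<Union> F"
proof -
  have "set xs \<subseteq> \<Union> (set (cycle_edges xs))"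
    unfolding cycle_edges_def using assms
    by (subst Union_walk_edges) (auto simp: vertex_cycle_def)
  also have "\<dots> \<subseteq> \<Union> F"
    using assms by (intro Union_mono) (simp add: vertex_cycle_def)
  finally show ?thesis .
qed

definition delete_vertex :: "'a \<Rightarrow> 'a set set \<Rightarrow> 'a set set" where
  "delete_vertex v F = {e \<in> F. v \<notin> e}"

definition suppress_weight ::
  "('a set \<Rightarrow> 'b::comm_monoid_add) \<Rightarrow> 'a \<Rightarrow> 'a \<Rightarrow> 'a \<Rightarrow> 'a set \<Rightarrow> 'b" where
  "suppress_weight w v a b = w({a, b} := w {v, a} + w {v, b})"

lemma delete_vertex_subset: "delete_vertex v F \<subseteq> F"
  by (auto simp: delete_vertex_def)

lemma map_suppress_weight:
  assumes "{a, b} \<notin> set es"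
  shows "map (suppress_weight w v a b) es = map w es"
  using assms by (intro map_cong) (auto simp: suppress_weight_def)

lemma vertex_cycle_suppress:
  assumes xs: "vertex_cycle (insert {a, b} (delete_vertex v F)) xs"
    and v: "{v, a} \<in> F" "{v, b} \<in> F" "v \<noteq> a" "v \<noteq> b"
  obtains ys where "vertex_cycle F ys"
    "cycle_weight w ys = cycle_weight (suppress_weight w v a b) xs"
proof (cases "{a, b} \<in> set (cycle_edges xs)")
  case False
  then have "vertex_cycle F xs"
    using xs delete_vertex_subset[of v F] by (auto simp: vertex_cycle_def)
  moreover have "cycle_weight w xs = cycle_weight (suppress_weight w v a b) xs"
    by (simp only: cycle_weight_def map_suppress_weight[OF False])
  ultimately show ?thesis
    by (rule that)
next
  case True
  then obtain ys zs x y E E' where split: "xs = ys @ zs" "{a, b} = {x, y}"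
    and edges: "cycle_edges xs = E @ {x, y} # E'"
    and new_edges: "cycle_edges (ys @ v # zs) = E @ {x, v} # {v, y} # E'"
    by (rule cycle_edges_subdivide) blast
  have "distinct (cycle_edges xs)"
    using xs by (auto simp: vertex_cycle_def intro: distinct_cycle_edges)
  then have once: "{a, b} \<notin> set E" "{a, b} \<notin> set E'"
    unfolding edges split(2) by auto
  then have "set E \<union> set E' \<subseteq> F"
    using xs delete_vertex_subset[of v F] unfolding vertex_cycle_def edges by auto
  moreover have xy: "{x, v} \<in> F" "{v, y} \<in> F"
      "suppress_weight w v a b {x, y} = w {x, v} + w {v, y}"
    using v split(2)
    by (auto simp: suppress_weight_def doubleton_eq_iff insert_commute add.commute)
  moreover have "v \<notin> set xs"
    using vertex_cycle_subset_Union[OF xs] v by (auto simp: delete_vertex_def)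
  ultimately have "vertex_cycle F (ys @ v # zs)"
    unfolding vertex_cycle_def new_edges using xs split(1) by (auto simp: vertex_cycle_def)
  moreover have "cycle_weight w (ys @ v # zs) = cycle_weight (suppress_weight w v a b) xs"
    unfolding cycle_weight_def new_edges edges
    by (simp add: xy(3) map_suppress_weight once add.assoc)
  ultimately show ?thesis
    by (rule that)
qed

section \<open>Paths with prescribed interior\<close>

definition linked :: "'a set set \<Rightarrow> 'a \<Rightarrow> 'a list \<Rightarrow> 'a \<Rightarrow> bool" where
  "linked F x P y \<longleftrightarrow> set (walk_edges (x # P @ [y])) \<subseteq> F"

definition link_weight ::
  "('a set \<Rightarrow> 'b::comm_monoid_add) \<Rightarrow> 'a \<Rightarrow> 'a list \<Rightarrow> 'a \<Rightarrow> 'b" where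
  "link_weight w x P y = (\<Sum>e\<leftarrow>walk_edges (x # P @ [y]). w e)"

lemma walk_edges_link_rev: "walk_edges (y # rev P @ [x]) = rev (walk_edges (x # P @ [y]))"
  using walk_edges_rev[of "x # P @ [y]"] by simp

lemma walk_edges_link_append:
  "walk_edges (x # (P @ y # Q) @ [z]) = walk_edges (x # P @ [y]) @ walk_edges (y # Q @ [z])"
  using walk_edges_append_Cons[of "x # P" y "Q @ [z]"] by simp

lemma linked_rev: "linked F y (rev P) x \<longleftrightarrow> linked F x P y"
  by (simp add: linked_def walk_edges_link_rev)

lemma linked_append: "linked F x (P @ y # Q) z \<longleftrightarrow> linked F x P y \<and> linked F y Q z"
  unfolding linked_def walk_edges_link_append by auto

lemma link_weight_rev: "link_weight w y (rev P) x = link_weight w x P y"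
  by (simp add: link_weight_def walk_edges_link_rev sum_list_rev flip: rev_map)

lemma link_weight_append:
  "link_weight w x (P @ y # Q) z = link_weight w x P y + link_weight w y Q z"
  unfolding link_weight_def walk_edges_link_append by simp

lemma vertex_cycle_of_links:
  assumes "distinct (x # y # P @ Q)" "P @ Q \<noteq> []" "linked F x P y" "linked F x Q y"
  shows "vertex_cycle F (x # P @ y # rev Q)"
    and "cycle_weight w (x # P @ y # rev Q) = link_weight w x P y + link_weight w x Q y"
proof -
  have "linked F x (P @ y # rev Q) x"
    using assms(3,4) by (simp add: linked_append linked_rev)
  then show "vertex_cycle F (x # P @ y # rev Q)"
    using assms(1,2) by (cases P; cases Q) (auto simp: vertex_cycle_def cycle_edges_def linked_def)
  show "cycle_weight w (x # P @ y # rev Q) = link_weight w x P y + link_weight w x Q y"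
    using link_weight_append[of w x P y "rev Q" x]
    by (simp add: cycle_weight_def cycle_edges_def link_weight_rev) (simp add: link_weight_def)
qed

section \<open>Subdivisions of the complete graph on four vertices\<close>

text \<open>The paths joining \<open>a\<close> to \<open>b\<close>, \<open>c\<close>, \<open>d\<close> have the interiors \<open>P\<close>, \<open>Q\<close>, \<open>R\<close>, and the paths
  opposite to them have the interiors \<open>P'\<close>, \<open>Q'\<close>, \<open>R'\<close>.\<close>

definition K4_subdivision :: "'a set set \<Rightarrow> 'a \<Rightarrow> 'a \<Rightarrow> 'a \<Rightarrow> 'a \<Rightarrow>
    'a list \<Rightarrow> 'a list \<Rightarrow> 'a list \<Rightarrow> 'a list \<Rightarrow> 'a list \<Rightarrow> 'a list \<Rightarrow> bool" where
  "K4_subdivision F a b c d P Q R P' Q' R' \<longleftrightarrow>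
     distinct ([a, b, c, d] @ P @ Q @ R @ P' @ Q' @ R') \<and>
     linked F a P b \<and> linked F a Q c \<and> linked F a R d \<and>
     linked F c P' d \<and> linked F b Q' d \<and> linked F b R' c"

definition contains_K4_subdivision :: "'a set set \<Rightarrow> bool" where
  "contains_K4_subdivision F \<longleftrightarrow>
     (\<exists>a b c d P Q R P' Q' R'. K4_subdivision F a b c d P Q R P' Q' R')"

lemma K4_subdivision_rotate:
  assumes "K4_subdivision F a b c d P Q R P' Q' R'"
  shows "K4_subdivision F a c d b Q R P (rev Q') (rev R') P'"
proof -
  have "mset ([a, b, c, d] @ P @ Q @ R @ P' @ Q' @ R') =
      mset ([a, c, d, b] @ Q @ R @ P @ rev Q' @ rev R' @ P')"
    by simp
  from mset_eq_imp_distinct_iff[OF this] show ?thesis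
    using assms unfolding K4_subdivision_def linked_rev by blast
qed

lemma K4_subdivision_swap:
  assumes "K4_subdivision F a b c d P Q R P' Q' R'"
  shows "K4_subdivision F c d a b P' (rev Q) (rev R') P (rev Q') (rev R)"
proof -
  have "mset ([a, b, c, d] @ P @ Q @ R @ P' @ Q' @ R') =
      mset ([c, d, a, b] @ P' @ rev Q @ rev R' @ P @ rev Q' @ rev R)"
    by simp
  from mset_eq_imp_distinct_iff[OF this] show ?thesis
    using assms unfolding K4_subdivision_def linked_rev by blast
qed

section \<open>Simple graphs\<close>

definition neighbours :: "'a set set \<Rightarrow> 'a \<Rightarrow> 'a set" where
  "neighbours F v = {u. {v, u} \<in> F}"

locale simple_graph =
  fixes V :: "'a set" and F :: "'a set set"
  assumes finite_verts: "finite V"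
    and edge_subset: "e \<in> F \<Longrightarrow> e \<subseteq> V"
    and card_edge: "e \<in> F \<Longrightarrow> card e = 2"
begin

lemma edgeE:
  assumes "e \<in> F"
  obtains a b where "e = {a, b}" "a \<noteq> b" "a \<in> V" "b \<in> V"
  using edge_subset[OF assms] card_edge[OF assms] by (auto simp: card_2_iff)

lemma edge_verts: "{u, v} \<in> F \<Longrightarrow> u \<noteq> v \<and> u \<in> V \<and> v \<in> V"
  using edge_subset[of "{u, v}"] card_edge[of "{u, v}"] by (cases "u = v") auto

lemma finite_edges: "finite F"
  by (rule finite_subset[of _ "Pow V"]) (use finite_verts edge_subset in auto)

lemma neighbours_subset: "neighbours F v \<subseteq> V - {v}"
  using edge_verts by (auto simp: neighbours_def)

lemma finite_neighbours: "finite (neighbours F v)"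
  using finite_subset[OF neighbours_subset] finite_verts by blast

end

section \<open>Graphs of minimum degree three\<close>

context simple_graph
begin

definition graph_path :: "'a list \<Rightarrow> bool" where
  "graph_path xs \<longleftrightarrow> distinct xs \<and> set xs \<subseteq> V \<and> set (walk_edges xs) \<subseteq> F"

definition longest_path :: "'a list \<Rightarrow> bool" where
  "longest_path xs \<longleftrightarrow> graph_path xs \<and> (\<forall>ys. graph_path ys \<longrightarrow> length ys \<le> length xs)"

lemma exists_longest_path: "\<exists>xs. longest_path xs"
proof -
  have "graph_path []"
    by (simp add: graph_path_def)
  moreover have "\<forall>xs. graph_path xs \<longrightarrow> length xs < Suc (card V)"
    using finite_verts by (metis card_mono distinct_card graph_path_def less_Suc_eq_le)
  ultimately show ?thesis
    unfolding longest_path_def by (rule ex_has_greatest_nat)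
qed

lemma longest_path_nonempty:
  assumes "longest_path xs" "V \<noteq> {}"
  shows "xs \<noteq> []"
proof -
  obtain v where "v \<in> V"
    using assms(2) by blast
  then have "graph_path [v]"
    by (simp add: graph_path_def)
  then show ?thesis
    using assms(1) by (auto simp: longest_path_def)
qed

lemma longest_path_neighbour:
  assumes "longest_path xs" "xs \<noteq> []" "{hd xs, u} \<in> F"
  shows "u \<in> set xs"
proof (rule ccontr)
  assume "u \<notin> set xs"
  then have "graph_path (u # xs)"
    using assms edge_verts by (cases xs) (auto simp: graph_path_def longest_path_def insert_commute)
  then show False
    using assms(1) by (auto simp: longest_path_def)
qed

text \<open>Choose a lasso with \<open>A\<close> as short as possible. As \<open>rev A @ B\<close> is a longest path too, each end
  of \<open>A\<close> has a third neighbour on the path, and by minimality it lies beyond \<open>hd B\<close>.\<close>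

definition lasso :: "'a list \<Rightarrow> 'a list \<Rightarrow> bool" where
  "lasso A B \<longleftrightarrow> longest_path (A @ B) \<and> 2 \<le> length A \<and> B \<noteq> [] \<and> {hd A, hd B} \<in> F"

lemma lasso_rev:
  assumes "lasso A B"
  shows "lasso (rev A) B"
proof -
  have nonempty: "A \<noteq> []" "B \<noteq> []"
    using assms by (auto simp: lasso_def)
  have "graph_path (rev A @ B)" "{hd (rev A), hd B} \<in> F"
    using assms walk_edges_append[OF nonempty] walk_edges_append[of "rev A" B] nonempty
    by (auto simp: lasso_def longest_path_def graph_path_def walk_edges_rev last_rev hd_rev)
  then show ?thesis
    using assms by (auto simp: lasso_def longest_path_def)
qed

lemma third_neighbour:
  assumes "3 \<le> card (neighbours F v)"
  obtains u where "{v, u} \<in> F" "u \<noteq> x" "u \<noteq> y"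
proof -
  have "\<not> neighbours F v \<subseteq> {x, y}"
  proof
    assume "neighbours F v \<subseteq> {x, y}"
    then have "card (neighbours F v) \<le> card {x, y}"
      by (intro card_mono) auto
    also have "\<dots> \<le> 2"
      by (simp add: card_insert_if)
    finally show False
      using assms by simp
  qed
  then show ?thesis
    using that by (auto simp: neighbours_def)
qed

lemma exists_lasso:
  assumes "V \<noteq> {}" "\<And>v. v \<in> V \<Longrightarrow> 3 \<le> card (neighbours F v)"
  shows "\<exists>A B. lasso A B"
proof -
  obtain L where longest: "longest_path L"
    using exists_longest_path by blast
  then obtain x L' where L_eq: "L = x # L'"
    using longest_path_nonempty[OF _ assms(1)] by (cases L) auto
  then have "x \<in> V"
    using longest by (simp add: longest_path_def graph_path_def)
  from third_neighbour[OF assms(2)[OF this]] obtain u where u: "{x, u} \<in> F" "u \<noteq> hd L'" by metis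
  then have "u \<in> set L'"
    using longest_path_neighbour[OF longest] L_eq edge_verts by fastforce
  then obtain C D where split: "L' = C @ u # D"
    by (meson split_list)
  with u(2) have "C \<noteq> []" by auto
  then have "lasso (x # C) (u # D)"
    using longest L_eq u(1) split by (cases C) (auto simp: lasso_def)
  then show ?thesis by blast
qed

lemma shortest_lasso_neighbour:
  assumes lasso: "lasso A B" and shortest: "\<And>A' B'. lasso A' B' \<Longrightarrow> length A \<le> length A'"
    and deg: "\<And>v. v \<in> V \<Longrightarrow> 3 \<le> card (neighbours F v)"
  obtains u where "u \<in> set (tl B)" "{hd A, u} \<in> F"
proof -
  obtain x y A' where A_eq: "A = x # y # A'"
    using lasso by (cases A; cases "tl A") (auto simp: lasso_def)
  then have "x \<in> V"
    using lasso by (auto simp: lasso_def longest_path_def graph_path_def)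
  from third_neighbour[OF deg[OF this]] obtain u
    where u: "{x, u} \<in> F" "u \<noteq> y" "u \<noteq> hd B" by metis
  have "u \<in> set (A @ B)"
    using longest_path_neighbour[of "A @ B" u] lasso A_eq u(1) by (auto simp: lasso_def)
  moreover have "u \<noteq> x"
    using u(1) edge_verts by blast
  moreover have "u \<notin> set A'"
  proof
    assume "u \<in> set A'"
    then obtain C D where split: "A' = C @ u # D"
      by (meson split_list)
    then have "lasso (x # y # C) (u # D @ B)"
      using lasso A_eq split u(1) by (auto simp: lasso_def)
    then show False
      using shortest A_eq split by fastforce
  qed
  ultimately have "u \<in> set (tl B)"
    using u(2,3) A_eq by (cases B) auto
  then show ?thesis
    using that u(1) A_eq by simp
qed

lemma lasso_imp_K4_subdivision:
  assumes lasso: "lasso A (z # B @ t # D)"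
    and t: "{hd A, t} \<in> F" and s: "{last A, s} \<in> F" "s \<in> set (t # D)"
  shows "contains_K4_subdivision F"
proof -
  obtain pre post where split: "t # D = pre @ s # post"
    using s(2) by (meson split_list)
  define E where "E = tl (pre @ [s])"
  have E: "t # E = pre @ [s]" "t # D = (t # E) @ post"
    using split by (cases pre; simp add: E_def)+
  obtain x A' y where A_eq: "A = x # A' @ [y]"
    using lasso by (cases A; cases "tl A" rule: rev_cases) (auto simp: lasso_def)
  have path: "graph_path ((x # A' @ y # z # B @ t # E) @ post)"
    using lasso A_eq E(2) by (simp add: lasso_def longest_path_def)
  have "walk_edges (x # A' @ y # z # B @ t # D) =
      walk_edges (x # A' @ [y]) @ {y, z} # walk_edges (z # B @ [t]) @ walk_edges (t # D)"
    using walk_edges_append_Cons[of "x # A'" y "z # B @ t # D"]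
      walk_edges_append_Cons[of "z # B" t D] by simp
  moreover have "set (walk_edges (t # E)) \<subseteq> set (walk_edges (t # D))"
    using walk_edges_append_Cons[of pre s post] by (simp add: split E(1))
  ultimately have sub: "linked F x A' y" "linked F z B t" "{y, z} \<in> F"
      "set (walk_edges (t # E)) \<subseteq> F"
    using lasso A_eq by (auto simp: lasso_def longest_path_def graph_path_def linked_def)
  have "walk_edges ((t # E) @ [y]) = walk_edges (t # E) @ [{y, s}]"
    unfolding E(1) using walk_edges_append[of "pre @ [s]" "[y]"] by (simp add: insert_commute)
  then have "linked F t E y"
    using sub(4) s(1) A_eq by (simp add: linked_def)
  moreover have "linked F x [] z" "linked F x [] t" "linked F y [] z"
    using lasso t A_eq sub(3) by (simp_all add: lasso_def linked_def)
  moreover have "distinct ([x, y, z, t] @ A' @ [] @ [] @ B @ rev E @ [])"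
    using path by (auto simp: graph_path_def)
  ultimately have "K4_subdivision F x y z t A' [] [] B (rev E) []"
    using sub(1,2) by (simp add: K4_subdivision_def linked_rev)
  then show ?thesis
    unfolding contains_K4_subdivision_def by blast
qed

theorem contains_K4_subdivision_if_min_degree_3:
  assumes "V \<noteq> {}" and deg: "\<And>v. v \<in> V \<Longrightarrow> 3 \<le> card (neighbours F v)"
  shows "contains_K4_subdivision F"
proof -
  obtain A B where lasso: "lasso A B"
    and shortest: "\<And>A' B'. lasso A' B' \<Longrightarrow> length A \<le> length A'"
    using exists_lasso[OF assms] ex_has_least_nat[of "\<lambda>(A, B). lasso A B" _ "\<lambda>(A, B). length A"]
    by fastforce
  obtain u where u: "u \<in> set (tl B)" "{hd A, u} \<in> F"
    using shortest_lasso_neighbour[OF lasso] shortest deg by metis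
  obtain u' where u': "u' \<in> set (tl B)" "{last A, u'} \<in> F"
    using shortest_lasso_neighbour[OF lasso_rev[OF lasso] _ deg] shortest
    by (metis hd_rev length_rev)
  obtain z C D where B_eq: "B = z # C @ u # D"
    using lasso split_list[OF u(1)] by (cases B) (auto simp: lasso_def)
  show ?thesis
  proof (cases "u' \<in> set (u # D)")
    case True
    then show ?thesis
      using lasso_imp_K4_subdivision[of A z C u D u'] lasso B_eq u(2) u'(2) by simp
  next
    case False
    then obtain pre post where "C = pre @ u' # post"
      using u'(1) B_eq split_list[of u' C] by auto
    then show ?thesis
      using lasso_imp_K4_subdivision[of "rev A" z pre u' "post @ u # D" u] lasso_rev[OF lasso]
        B_eq u(2) u'(2) by (simp add: hd_rev last_rev)
  qed
qed

end

section \<open>Graphs whose cycle weights are 1 or 2 modulo 4\<close>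

lemma odd_if_pair_sums_mod4:
  fixes l m n :: nat
  assumes "(l + m) mod 4 \<in> {1, 2}" "(l + n) mod 4 \<in> {1, 2}" "(m + n) mod 4 \<in> {1, 2}"
  shows "odd l \<or> odd m"
proof (rule ccontr)
  assume "\<not> ?thesis"
  then have "l mod 4 = 0 \<or> l mod 4 = 2" "m mod 4 = 0 \<or> m mod 4 = 2"
    by presburger+
  moreover have "n mod 4 = 0 \<or> n mod 4 = 1 \<or> n mod 4 = 2 \<or> n mod 4 = 3"
    by linarith
  moreover have "(l mod 4 + m mod 4) mod 4 \<in> {1, 2}" "(l mod 4 + n mod 4) mod 4 \<in> {1, 2}"
      "(m mod 4 + n mod 4) mod 4 \<in> {1, 2}"
    using assms by (simp_all only: mod_add_eq)
  ultimately show False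
    by (elim disjE) (simp_all only:, simp_all)
qed

locale mod4_weighted_graph = simple_graph V F for V :: "'a set" and F :: "'a set set" +
  fixes w :: "'a set \<Rightarrow> nat"
  assumes cycle_weight_mod4: "vertex_cycle F xs \<Longrightarrow> cycle_weight w xs mod 4 \<in> {1, 2}"
begin

lemma theta_at_most_one_even:
  assumes "distinct (x # y # P @ Q @ R)" "Q \<noteq> []" "R \<noteq> []"
    and "linked F x P y" "linked F x Q y" "linked F x R y"
  shows "odd (link_weight w x P y) \<or> odd (link_weight w x Q y)"
    and "odd (link_weight w x P y) \<or> odd (link_weight w x R y)"
    and "odd (link_weight w x Q y) \<or> odd (link_weight w x R y)"
proof -
  have sum: "(link_weight w x S y + link_weight w x T y) mod 4 \<in> {1, 2}"
    if "distinct (x # y # S @ T)" "S @ T \<noteq> []" "linked F x S y" "linked F x T y" for S T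
    using cycle_weight_mod4[OF vertex_cycle_of_links(1)[OF that]]
      vertex_cycle_of_links(2)[OF that, where w = w]
    by simp
  have PQ: "(link_weight w x P y + link_weight w x Q y) mod 4 \<in> {1, 2}"
    and PR: "(link_weight w x P y + link_weight w x R y) mod 4 \<in> {1, 2}"
    and QR: "(link_weight w x Q y + link_weight w x R y) mod 4 \<in> {1, 2}"
    by (rule sum; use assms in \<open>simp add: Int_Un_distrib\<close>)+
  show "odd (link_weight w x P y) \<or> odd (link_weight w x Q y)"
    by (rule odd_if_pair_sums_mod4[OF PQ PR QR])
  show "odd (link_weight w x P y) \<or> odd (link_weight w x R y)"
    by (rule odd_if_pair_sums_mod4[OF PR PQ]) (use QR in \<open>simp add: add.commute\<close>)
  show "odd (link_weight w x Q y) \<or> odd (link_weight w x R y)"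
    by (rule odd_if_pair_sums_mod4[of _ _ "link_weight w x P y"])
      (use PQ PR QR in \<open>simp_all add: add.commute\<close>)
qed

lemma K4_subdivision_at_most_one_even:
  assumes "K4_subdivision F a b c d P Q R P' Q' R'"
  defines "p \<equiv> link_weight w a P b" and "q \<equiv> link_weight w a Q c" and "r \<equiv> link_weight w a R d"
    and "q' \<equiv> link_weight w b Q' d" and "r' \<equiv> link_weight w b R' c"
  shows "odd p \<or> odd (q + r')" "odd p \<or> odd (r + q')" "odd (q + r') \<or> odd (r + q')"
proof -
  have "mset ([a, b, c, d] @ P @ Q @ R @ P' @ Q' @ R') =
      mset ((a # b # P @ (Q @ c # rev R') @ (R @ d # rev Q')) @ P')"
    by simp
  from mset_eq_imp_distinct_iff[OF this]
  have "distinct (a # b # P @ (Q @ c # rev R') @ (R @ d # rev Q'))"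
    using assms(1) unfolding K4_subdivision_def distinct_append by blast
  moreover have "linked F a P b" "linked F a (Q @ c # rev R') b" "linked F a (R @ d # rev Q') b"
    using assms(1) by (auto simp: K4_subdivision_def linked_append linked_rev)
  ultimately show "odd p \<or> odd (q + r')" "odd p \<or> odd (r + q')" "odd (q + r') \<or> odd (r + q')"
    using theta_at_most_one_even[of a b P "Q @ c # rev R'" "R @ d # rev Q'"]
    by (simp_all add: link_weight_append link_weight_rev p_def q_def r_def q'_def r'_def)
qed

text \<open>If all six paths are odd, then both detours from \<open>a\<close> to \<open>b\<close> are even. If the path \<open>ab\<close> is
  even, then so is \<open>ac\<close> or \<open>bc\<close>, say \<open>ac\<close>, and the theta graphs at \<open>ab\<close>, \<open>ac\<close>, \<open>bc\<close> make
  \<open>ad + bd\<close>, \<open>ad + cd\<close>, \<open>bd + cd\<close> odd, although their sum is even.\<close>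

lemma not_contains_K4_subdivision: "\<not> contains_K4_subdivision F"
proof
  assume "contains_K4_subdivision F"
  then obtain a b c d P Q R P' Q' R' where ab: "K4_subdivision F a b c d P Q R P' Q' R'"
    unfolding contains_K4_subdivision_def by blast
  note ac = K4_subdivision_rotate[OF ab]
  note ad = K4_subdivision_rotate[OF ac]
  note thetas = ab ac ad K4_subdivision_swap[OF ab] K4_subdivision_swap[OF ac]
    K4_subdivision_swap[OF ad]
  show False
    using thetas[THEN K4_subdivision_at_most_one_even(1)]
      thetas[THEN K4_subdivision_at_most_one_even(2)]
      thetas[THEN K4_subdivision_at_most_one_even(3)]
    unfolding link_weight_rev rev_rev_ident even_add by argo
qed

lemma exists_vertex_degree_le_2:
  assumes "V \<noteq> {}"
  obtains v where "v \<in> V" "card (neighbours F v) \<le> 2"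
  using contains_K4_subdivision_if_min_degree_3[OF assms] not_contains_K4_subdivision
  by (metis not_less_eq_eq numeral_2_eq_2 numeral_3_eq_3)

lemma mod4_weighted_graph_delete: "mod4_weighted_graph (V - {v}) (delete_vertex v F) w"
proof
  show "cycle_weight w xs mod 4 \<in> {1, 2}" if "vertex_cycle (delete_vertex v F) xs" for xs
    using vertex_cycle_mono[OF that delete_vertex_subset] by (rule cycle_weight_mod4)
qed (use finite_verts edge_subset card_edge in \<open>auto simp: delete_vertex_def\<close>)

lemma mod4_weighted_graph_suppress:
  assumes "{v, a} \<in> F" "{v, b} \<in> F" "a \<noteq> b"
  shows "mod4_weighted_graph (V - {v}) (insert {a, b} (delete_vertex v F))
    (suppress_weight w v a b)"
proof
  have v: "v \<noteq> a" "v \<noteq> b" "a \<in> V" "b \<in> V"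
    using edge_verts assms by blast+
  show "cycle_weight (suppress_weight w v a b) xs mod 4 \<in> {1, 2}"
    if "vertex_cycle (insert {a, b} (delete_vertex v F)) xs" for xs
    using vertex_cycle_suppress[OF that assms(1,2) v(1,2), of w] cycle_weight_mod4 by metis
  show "e \<subseteq> V - {v}" "card e = 2" if "e \<in> insert {a, b} (delete_vertex v F)" for e
    using that v assms(3) edge_subset card_edge by (auto simp: delete_vertex_def)
qed (use finite_verts in auto)

end

section \<open>2-trees\<close>

inductive two_tree :: "'a set \<Rightarrow> 'a set set \<Rightarrow> bool" where
  edge: "a \<noteq> b \<Longrightarrow> two_tree {a, b} {{a, b}}"
| attach: "two_tree V F \<Longrightarrow> {a, b} \<in> F \<Longrightarrow> v \<notin> V \<Longrightarrow>
    two_tree (insert v V) (insert {v, a} (insert {v, b} F))"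

lemma two_tree_simple_graph: "two_tree V F \<Longrightarrow> simple_graph V F"
proof (induction rule: two_tree.induct)
  case (edge a b)
  then show ?case by unfold_locales auto
next
  case (attach V F a b v)
  interpret simple_graph V F by (rule attach.IH)
  have "v \<noteq> a" "v \<noteq> b" "a \<in> V" "b \<in> V"
    using edge_verts attach.hyps by blast+
  then show ?case
    using finite_verts edge_subset card_edge by unfold_locales auto
qed

lemma two_tree_incident:
  assumes "two_tree V F" "a \<in> V"
  obtains b where "{a, b} \<in> F"
  using assms by (induction arbitrary: thesis rule: two_tree.induct) (auto simp: insert_commute)

lemma (in mod4_weighted_graph) two_tree_without_low_degree_vertex:
  assumes v: "card (neighbours F v) \<le> 2" "V - {v} \<noteq> {}"
    and smaller: "\<And>F' w'. mod4_weighted_graph (V - {v}) F' w' \<Longrightarrow>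
      \<exists>T. two_tree (V - {v}) T \<and> F' \<subseteq> T"
  obtains T a b where "two_tree (V - {v}) T" "delete_vertex v F \<subseteq> T" "{a, b} \<in> T"
    "neighbours F v \<subseteq> {a, b}"
proof (cases "card (neighbours F v) = 2")
  case True
  then obtain a b where ab: "neighbours F v = {a, b}" "a \<noteq> b"
    by (auto simp: card_2_iff)
  then have "{v, a} \<in> F" "{v, b} \<in> F"
    by (auto simp: neighbours_def)
  from smaller[OF mod4_weighted_graph_suppress[OF this ab(2)]] show ?thesis
    using that ab by auto
next
  case False
  then have "card (neighbours F v) = 0 \<or> card (neighbours F v) = 1"
    using v(1) by linarith
  then obtain a where a: "a \<in> V - {v}" "neighbours F v \<subseteq> {a}"
    using v(2) finite_neighbours[of v] neighbours_subset[of v]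
    by (auto simp: card_1_singleton_iff)
  obtain T where T: "two_tree (V - {v}) T" "delete_vertex v F \<subseteq> T"
    using smaller[OF mod4_weighted_graph_delete] by blast
  from two_tree_incident[OF T(1) a(1)] obtain b where "{a, b} \<in> T" .
  then show ?thesis
    using that T a(2) by blast
qed

theorem mod4_weighted_graph_subset_two_tree:
  assumes "mod4_weighted_graph V F w" "2 \<le> card V"
  shows "\<exists>T. two_tree V T \<and> F \<subseteq> T"
  using assms
proof (induction "card V" arbitrary: V F w rule: less_induct)
  case less
  interpret mod4_weighted_graph V F w
    by (rule less.prems(1))
  show ?case
  proof (cases "card V = 2")
    case True
    then obtain a b where "V = {a, b}" "a \<noteq> b"
      by (auto simp: card_2_iff)
    then have "F \<subseteq> {{a, b}}"
      by (auto elim!: edgeE)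
    then show ?thesis
      using two_tree.edge[OF \<open>a \<noteq> b\<close>] \<open>V = {a, b}\<close> by blast
  next
    case False
    obtain v where v: "v \<in> V" "card (neighbours F v) \<le> 2"
      using exists_vertex_degree_le_2 less.prems(2) by (metis card.empty not_numeral_le_zero)
    have smaller: "card (V - {v}) < card V" "2 \<le> card (V - {v})"
      using v(1) finite_verts less.prems(2) False by (auto simp: card_Diff_singleton card_gt_0_iff)
    then have "V - {v} \<noteq> {}" by force
    from two_tree_without_low_degree_vertex[OF v(2) this less.hyps[OF smaller(1) _ smaller(2)]]
    obtain T a b where T: "two_tree (V - {v}) T" "delete_vertex v F \<subseteq> T" "{a, b} \<in> T"
        "neighbours F v \<subseteq> {a, b}" .
    have "two_tree V (insert {v, a} (insert {v, b} T))"
      using two_tree.attach[OF T(1,3), of v] v(1) by (simp add: insert_absorb)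
    moreover have "e \<in> insert {v, a} (insert {v, b} T)" if "e \<in> F" for e
    proof (cases "v \<in> e")
      case True
      then obtain u where "e = {v, u}"
        using \<open>e \<in> F\<close> by (auto elim!: edgeE simp: insert_commute)
      then show ?thesis
        using \<open>e \<in> F\<close> T(4) by (auto simp: neighbours_def)
    qed (use \<open>e \<in> F\<close> T(2) in \<open>auto simp: delete_vertex_def\<close>)
    ultimately show ?thesis by blast
  qed
qed

section \<open>Geometric complexes\<close>

text \<open>The intersection is formed before \<open>\<phi>\<close> is applied, so that for singletons the condition says
  that \<open>\<phi>\<close> is injective.\<close>

definition geometric_complex :: "'a set set \<Rightarrow> ('a \<Rightarrow> 'b::euclidean_space) \<Rightarrow> bool" where
  "geometric_complex K \<phi> \<longleftrightarrow>
     (\<forall>s \<in> K. \<forall>t \<in> K. convex hull (\<phi> ` s) \<inter> convex hull (\<phi> ` t) \<subseteq> convex hull (\<phi> ` (s \<inter> t)))"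

lemma geometric_complexD:
  assumes "geometric_complex K \<phi>" "s \<in> K" "t \<in> K"
  shows "convex hull (\<phi> ` s) \<inter> convex hull (\<phi> ` t) \<subseteq> convex hull (\<phi> ` (s \<inter> t))"
  using assms by (simp add: geometric_complex_def)

lemma geometric_complex_vertex:
  assumes "geometric_complex K \<phi>" "s \<in> K" "{x} \<in> K" "\<phi> x \<in> convex hull (\<phi> ` s)"
  shows "x \<in> s"
proof (rule ccontr)
  assume "x \<notin> s"
  then have "s \<inter> {x} = {}" by simp
  moreover have "\<phi> x \<in> convex hull (\<phi> ` (s \<inter> {x}))"
    using geometric_complexD[OF assms(1-3)] assms(4) by auto
  ultimately show False by simp
qed

lemma geometric_complex_cong:
  assumes "\<And>x. x \<in> \<Union> K \<Longrightarrow> \<phi> x = \<psi> x"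
  shows "geometric_complex K \<phi> \<longleftrightarrow> geometric_complex K \<psi>"
proof -
  have image: "\<phi> ` s = \<psi> ` s" if "s \<subseteq> \<Union> K" for s
    using that by (intro image_cong refl assms) auto
  have "\<phi> ` s = \<psi> ` s \<and> \<phi> ` (s \<inter> t) = \<psi> ` (s \<inter> t)" if "s \<in> K" for s t
    using that by (intro conjI image) auto
  then show ?thesis
    by (simp add: geometric_complex_def)
qed

lemma geometric_complex_Un:
  assumes "geometric_complex K \<phi>" "geometric_complex L \<phi>"
    and "\<And>s t. s \<in> K \<Longrightarrow> t \<in> L \<Longrightarrow>
      convex hull (\<phi> ` s) \<inter> convex hull (\<phi> ` t) \<subseteq> convex hull (\<phi> ` (s \<inter> t))"
  shows "geometric_complex (K \<union> L) \<phi>"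
proof -
  have "convex hull (\<phi> ` t) \<inter> convex hull (\<phi> ` s) \<subseteq> convex hull (\<phi> ` (t \<inter> s))"
    if "s \<in> K" "t \<in> L" for s t
    using assms(3)[OF that] by (simp only: Int_commute)
  with assms show ?thesis
    unfolding geometric_complex_def by (simp add: ball_Un)
qed

lemma geometric_complex_simplex:
  assumes "inj_on \<phi> s" "\<not> affine_dependent (\<phi> ` s)" "K \<subseteq> Pow s"
  shows "geometric_complex K \<phi>"
  unfolding geometric_complex_def
proof (intro ballI)
  fix t u
  assume "t \<in> K" "u \<in> K"
  then have tu: "t \<subseteq> s" "u \<subseteq> s"
    using assms(3) by auto
  then have "\<phi> ` t \<union> \<phi> ` u \<subseteq> \<phi> ` s"
    by auto
  then have "\<not> affine_dependent (\<phi> ` t \<union> \<phi> ` u)"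
    using assms(2) affine_independent_subset by blast
  then show "convex hull (\<phi> ` t) \<inter> convex hull (\<phi> ` u) \<subseteq> convex hull (\<phi> ` (t \<inter> u))"
    by (simp add: convex_hull_Int inj_on_image_Int[OF assms(1) tu])
qed

lemma geometric_complex_attach:
  assumes K: "geometric_complex K \<phi>" and v: "v \<notin> \<Union> K" "v \<notin> s"
    and s: "inj_on \<phi> s" "p \<notin> \<phi> ` s" "\<not> affine_dependent (insert p (\<phi> ` s))"
    and meet: "\<And>t. t \<in> K \<Longrightarrow>
      convex hull (\<phi> ` t) \<inter> convex hull (insert p (\<phi> ` s)) \<subseteq> convex hull (\<phi> ` (t \<inter> s))"
    and L: "L \<subseteq> Pow (insert v s)"
  shows "geometric_complex (K \<union> L) (\<phi>(v := p))"
proof -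
  define \<psi> where "\<psi> = \<phi>(v := p)"
  have old: "\<psi> ` t = \<phi> ` t" if "v \<notin> t" for t
    using that by (auto simp: \<psi>_def)
  have new: "\<psi> ` insert v s = insert p (\<phi> ` s)"
    by (simp add: old v(2)) (simp add: \<psi>_def)
  have "inj_on \<psi> (insert v s)"
    using s(1,2) v(2) by (auto simp: \<psi>_def inj_on_def)
  then have simplex: "geometric_complex (Pow (insert v s)) \<psi>"
    by (rule geometric_complex_simplex) (use s(3) new in auto)
  have "geometric_complex (K \<union> L) \<psi>"
  proof (rule geometric_complex_Un)
    show "geometric_complex K \<psi>"
      using v(1) by (intro geometric_complex_cong[THEN iffD1, OF _ K]) (auto simp: \<psi>_def)
    show "geometric_complex L \<psi>"
      using simplex L by (auto simp: geometric_complex_def)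
  next
    fix t u
    assume "t \<in> K" "u \<in> L"
    then have "v \<notin> t" "u \<subseteq> insert v s"
      using v(1) L by auto
    then have "convex hull (\<psi> ` u) \<subseteq> convex hull (insert p (\<phi> ` s))"
      unfolding new[symmetric] by (intro hull_mono image_mono)
    then have "convex hull (\<psi> ` t) \<inter> convex hull (\<psi> ` u) \<subseteq>
        convex hull (\<psi> ` (t \<inter> s)) \<inter> convex hull (\<psi> ` u)"
      using meet[OF \<open>t \<in> K\<close>] \<open>v \<notin> t\<close> by (auto simp: old)
    also have "\<dots> \<subseteq> convex hull (\<psi> ` (t \<inter> s \<inter> u))"
      using \<open>u \<subseteq> insert v s\<close> by (intro geometric_complexD[OF simplex]) auto
    also have "\<dots> \<subseteq> convex hull (\<psi> ` (t \<inter> u))"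
      by (intro hull_mono image_mono) auto
    finally show "convex hull (\<psi> ` t) \<inter> convex hull (\<psi> ` u) \<subseteq> convex hull (\<psi> ` (t \<inter> u))" .
  qed
  then show ?thesis
    by (simp add: \<psi>_def)
qed

section \<open>Thin triangles\<close>

lemma eventually_disjoint_hull_insert:
  fixes C K :: "'a::euclidean_space set"
  assumes "compact C" "convex C" "closed K" "C \<inter> K = {}" "m \<in> C"
  shows "\<forall>\<^sub>F p in nhds m. K \<inter> convex hull (insert p C) = {}"
proof -
  obtain d where d: "0 < d" "\<And>x y. x \<in> C \<Longrightarrow> y \<in> K \<Longrightarrow> d \<le> dist x y"
    using separate_compact_closed[OF assms(1,3,4)] by blast
  have "\<forall>\<^sub>F p in nhds m. dist p m < d"
    using d(1) by (auto simp: eventually_nhds_metric)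
  then show ?thesis
  proof eventually_elim
    case (elim p)
    have False if x_in: "x \<in> K" "x \<in> convex hull (insert p C)" for x
    proof -
      obtain u v c where x: "0 \<le> u" "0 \<le> v" "u + v = 1" "c \<in> C" "x = u *\<^sub>R p + v *\<^sub>R c"
        using x_in(2) assms(2,5) convex_hull_insert[of C p] by (auto simp: hull_same)
      have "u *\<^sub>R m + v *\<^sub>R c \<in> C"
        using assms(2,5) x by (intro convexD) auto
      from d(2)[OF this x_in(1)] have "d \<le> norm (u *\<^sub>R (m - p))"
        by (simp add: dist_norm x(5) algebra_simps)
      also have "\<dots> \<le> dist p m"
        using x by (simp add: dist_norm norm_minus_commute mult_left_le_one_le)
      finally show False
        using elim by simp
    qed
    then show ?case by blast
  qed
qed

lemma eventually_disjoint_triangle: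
  fixes a b m :: "'a::euclidean_space"
  assumes "closed K" "K \<inter> closed_segment a b = {}" "m \<in> closed_segment a b"
  shows "\<forall>\<^sub>F p in nhds m. K \<inter> convex hull {p, a, b} = {}"
proof -
  have "\<forall>\<^sub>F p in nhds m. K \<inter> convex hull (insert p (closed_segment a b)) = {}"
    using assms by (intro eventually_disjoint_hull_insert) auto
  then show ?thesis
  proof eventually_elim
    case (elim p)
    have "convex hull {p, a, b} \<subseteq> convex hull (insert p (closed_segment a b))"
      by (intro hull_mono) auto
    with elim show ?case by blast
  qed
qed

definition ray :: "'a::real_vector \<Rightarrow> 'a \<Rightarrow> 'a set" where
  "ray a d = (\<lambda>s. a + s *\<^sub>R d) ` {0..}"

lemma closed_ray:
  fixes a d :: "'a::euclidean_space"
  shows "closed (ray a d)"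
proof (cases "d = 0")
  case False
  then have "closed ((\<lambda>s. s *\<^sub>R d) ` {0..})"
    by (intro closed_injective_linear_image) (auto simp: linear_iff inj_on_def algebra_simps)
  from closed_translation[OF this, of a] show ?thesis
    by (simp add: ray_def image_image)
qed (auto simp: ray_def image_constant_conv)

lemma closed_segment_subset_ray: "closed_segment a c \<subseteq> ray a (c - a)"
proof
  fix x
  assume "x \<in> closed_segment a c"
  then obtain s where "0 \<le> s" "x = a + s *\<^sub>R (c - a)"
    by (auto simp: closed_segment_def algebra_simps)
  then show "x \<in> ray a (c - a)"
    by (auto simp: ray_def)
qed

lemma ray_Int_closed_segment_subset:
  fixes a b c :: "'a::euclidean_space"
  assumes "closed_segment a c \<inter> closed_segment a b \<subseteq> {a}"
  shows "ray a (c - a) \<inter> closed_segment a b \<subseteq> {a}"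
proof
  fix x
  assume "x \<in> ray a (c - a) \<inter> closed_segment a b"
  then obtain s where s: "0 \<le> s" "x = a + s *\<^sub>R (c - a)" and x: "x \<in> closed_segment a b"
    by (auto simp: ray_def)
  define y where "y = a + min s 1 *\<^sub>R (c - a)"
  have "y \<in> closed_segment a c"
    using s(1) by (auto simp: y_def closed_segment_def algebra_simps intro!: exI[of _ "min s 1"])
  moreover have "y = a + (min s 1 / s) *\<^sub>R (x - a)" "min s 1 / s \<le> 1"
    using s by (cases "s = 0"; auto simp: y_def divide_le_eq_1)+
  then have "y \<in> closed_segment a x"
    using s(1) by (auto simp: closed_segment_def algebra_simps intro!: exI[of _ "min s 1 / s"])
  then have "y \<in> closed_segment a b"
    using x by (meson ends_in_segment(1) subset_closed_segment subsetD)
  ultimately have "y = a"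
    using assms by blast
  then show "x \<in> {a}"
    using s by (auto simp: y_def min_def split: if_splits)
qed

lemma ray_meets_opposite_side:
  assumes x: "x \<in> ray a d" "x \<in> convex hull {a, p, b}" "x \<noteq> a"
  shows "ray a d \<inter> closed_segment p b \<noteq> {}"
proof -
  obtain u v y where y: "0 \<le> v" "u + v = 1" "y \<in> closed_segment p b" "x = u *\<^sub>R a + v *\<^sub>R y"
    using x(2) convex_hull_insert[of "{p, b}" a] by (auto simp: segment_convex_hull)
  obtain l where l: "0 \<le> l" "x = a + l *\<^sub>R d"
    using x(1) by (auto simp: ray_def)
  have "v \<noteq> 0"
    using y x(3) by auto
  have "u = 1 - v"
    using y(2) by simp
  have scaled: "v *\<^sub>R (y - a) = l *\<^sub>R d"
    using y(4) l(2) unfolding \<open>u = 1 - v\<close> by (simp add: algebra_simps)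
  have "y = a + (1 / v) *\<^sub>R (v *\<^sub>R (y - a))"
    using \<open>v \<noteq> 0\<close> by simp
  also have "\<dots> = a + (l / v) *\<^sub>R d"
    unfolding scaled by simp
  finally have "y = a + (l / v) *\<^sub>R d" .
  then have "y \<in> ray a d"
    using l(1) y(1) unfolding ray_def by (intro image_eqI[of _ _ "l / v"]) auto
  then show ?thesis
    using y(3) by blast
qed

text \<open>If the segment \<open>[a, c]\<close> contains a point of the triangle \<open>abp\<close> other than \<open>a\<close>, then the ray
  from \<open>a\<close> through \<open>c\<close> meets the side \<open>[p, b]\<close>; but it has a positive distance to \<open>[m, b]\<close>.\<close>

lemma eventually_segment_Int_triangle_subset:
  fixes a b c m :: "'a::euclidean_space"
  assumes "m \<in> closed_segment a b" "m \<noteq> a" "closed_segment a c \<inter> closed_segment a b \<subseteq> {a}"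
  shows "\<forall>\<^sub>F p in nhds m. closed_segment a c \<inter> convex hull {p, a, b} \<subseteq> {a}"
proof -
  have "closed_segment m b \<subseteq> closed_segment a b"
    using assms(1) by (simp add: subset_closed_segment)
  moreover have "a \<notin> closed_segment m b"
    using assms(1,2) by (auto simp: between_mem_segment[symmetric] dest: between_antisym)
  ultimately have "closed_segment m b \<inter> ray a (c - a) = {}"
    using ray_Int_closed_segment_subset[OF assms(3)] by blast
  then have "\<forall>\<^sub>F p in nhds m. ray a (c - a) \<inter> convex hull (insert p (closed_segment m b)) = {}"
    by (intro eventually_disjoint_hull_insert closed_ray) auto
  then show ?thesis
  proof eventually_elim
    case (elim p)
    have "closed_segment p b \<subseteq> convex hull (insert p (closed_segment m b))"
      unfolding segment_convex_hull[of p b] by (intro hull_mono) auto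
    then have "ray a (c - a) \<inter> closed_segment p b = {}"
      using elim by blast
    then show ?case
      using ray_meets_opposite_side[of _ a "c - a" p b] closed_segment_subset_ray[of a c]
      by (auto simp: insert_commute)
  qed
qed

section \<open>Straight-line drawings\<close>

definition graph_complex :: "'a set \<Rightarrow> 'a set set \<Rightarrow> 'a set set" where
  "graph_complex V F = (\<lambda>x. {x}) ` V \<union> F"

definition straight_line_drawing ::
  "'a set \<Rightarrow> 'a set set \<Rightarrow> ('a \<Rightarrow> 'b::euclidean_space) \<Rightarrow> bool" where
  "straight_line_drawing V F = geometric_complex (graph_complex V F)"

lemma in_graph_complex [simp]:
  "x \<in> V \<Longrightarrow> {x} \<in> graph_complex V F" "e \<in> F \<Longrightarrow> e \<in> graph_complex V F"
  by (auto simp: graph_complex_def)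

lemma straight_line_drawing_inj:
  assumes "straight_line_drawing V F \<phi>"
  shows "inj_on \<phi> V"
proof
  show "x = y" if "x \<in> V" "y \<in> V" "\<phi> x = \<phi> y" for x y
    using geometric_complex_vertex[OF assms[unfolded straight_line_drawing_def], of "{y}" x] that
    by simp
qed

context simple_graph
begin

lemma straight_line_drawing_Int_vertices:
  assumes "straight_line_drawing V F \<phi>" "e \<in> F"
  shows "convex hull (\<phi> ` e) \<inter> \<phi> ` V = \<phi> ` e"
  using geometric_complex_vertex[OF assms(1)[unfolded straight_line_drawing_def], of e] assms(2)
    edge_subset[OF assms(2)] by (auto intro: hull_inc)

lemma straight_line_drawing_Int_edges:
  assumes "straight_line_drawing V F \<phi>" "e \<in> F" "f \<in> F" "e \<noteq> f"
  shows "convex hull (\<phi> ` e) \<inter> convex hull (\<phi> ` f) \<subseteq> \<phi> ` (e \<inter> f)"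
proof -
  have "e \<inter> f = {} \<or> (\<exists>x. e \<inter> f = {x})"
    using assms(2-4) by (elim edgeE) auto
  then show ?thesis
    using geometric_complexD[OF assms(1)[unfolded straight_line_drawing_def], of e f] assms(2,3)
    by auto
qed

lemma eventually_triangle_Int_face_subset:
  fixes \<phi> :: "'a \<Rightarrow> 'b::euclidean_space"
  assumes \<phi>: "straight_line_drawing V F \<phi>" and ab: "{a, b} \<in> F"
    and e: "e \<in> graph_complex V F"
  shows "\<forall>\<^sub>F p in nhds (midpoint (\<phi> a) (\<phi> b)).
    convex hull (\<phi> ` e) \<inter> convex hull {p, \<phi> a, \<phi> b} \<subseteq> convex hull (\<phi> ` (e \<inter> {a, b}))"
proof -
  have "\<phi> a \<noteq> \<phi> b"
    using inj_onD[OF straight_line_drawing_inj[OF \<phi>]] edge_verts[OF ab] by blast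
  have meet: "convex hull (\<phi> ` e) \<inter> closed_segment (\<phi> a) (\<phi> b) \<subseteq> convex hull (\<phi> ` (e \<inter> {a, b}))"
    using geometric_complexD[OF \<phi>[unfolded straight_line_drawing_def] e, of "{a, b}"] ab
    by (simp add: segment_convex_hull)
  obtain x y where xy: "e = {x, y}"
    using e by (auto simp: graph_complex_def elim: edgeE)
  then consider (disjoint) "e \<inter> {a, b} = {}" | (same) "e = {a, b}"
    | (at_a) c where "e = {a, c}" "e \<inter> {a, b} = {a}"
    | (at_b) c where "e = {b, c}" "e \<inter> {a, b} = {b}"
    by (cases "x \<in> {a, b}"; cases "y \<in> {a, b}") (auto simp: insert_commute)
  then show ?thesis
  proof cases
    case disjoint
    then have "convex hull (\<phi> ` e) \<inter> closed_segment (\<phi> a) (\<phi> b) = {}"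
      using meet by simp
    moreover have "closed (convex hull (\<phi> ` e))"
      by (simp add: xy flip: segment_convex_hull)
    ultimately show ?thesis
      using eventually_disjoint_triangle[of "convex hull (\<phi> ` e)" "\<phi> a" "\<phi> b"] disjoint by simp
  next
    case same
    then show ?thesis by simp
  next
    case (at_a c)
    then have "convex hull (\<phi> ` e) = closed_segment (\<phi> a) (\<phi> c)"
      by (simp add: segment_convex_hull)
    then show ?thesis
      using eventually_segment_Int_triangle_subset[of "midpoint (\<phi> a) (\<phi> b)" "\<phi> a" "\<phi> b" "\<phi> c"]
        meet \<open>\<phi> a \<noteq> \<phi> b\<close> by (simp add: at_a(2))
  next
    case (at_b c)
    then have "convex hull (\<phi> ` e) = closed_segment (\<phi> b) (\<phi> c)"
      by (simp add: segment_convex_hull)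
    then show ?thesis
      using eventually_segment_Int_triangle_subset[of "midpoint (\<phi> a) (\<phi> b)" "\<phi> b" "\<phi> a" "\<phi> c"]
        meet \<open>\<phi> a \<noteq> \<phi> b\<close> by (simp add: at_b(2) insert_commute midpoint_sym closed_segment_commute)
  qed
qed

lemma exists_apex:
  fixes \<phi> :: "'a \<Rightarrow> 'b::euclidean_space"
  assumes dim: "2 \<le> DIM('b)" and \<phi>: "straight_line_drawing V F \<phi>" and ab: "{a, b} \<in> F"
  obtains p where "p \<notin> affine hull {\<phi> a, \<phi> b}"
    "\<And>e. e \<in> graph_complex V F \<Longrightarrow>
      convex hull (\<phi> ` e) \<inter> convex hull {p, \<phi> a, \<phi> b} \<subseteq> convex hull (\<phi> ` (e \<inter> {a, b}))"
proof -
  have "\<forall>\<^sub>F p in nhds (midpoint (\<phi> a) (\<phi> b)). \<forall>e \<in> graph_complex V F.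
      convex hull (\<phi> ` e) \<inter> convex hull {p, \<phi> a, \<phi> b} \<subseteq> convex hull (\<phi> ` (e \<inter> {a, b}))"
    using finite_verts finite_edges eventually_triangle_Int_face_subset[OF \<phi> ab]
    by (intro eventually_ball_finite) (auto simp: graph_complex_def)
  then obtain U where U: "open U" "midpoint (\<phi> a) (\<phi> b) \<in> U"
    and clear: "\<And>p e. p \<in> U \<Longrightarrow> e \<in> graph_complex V F \<Longrightarrow>
      convex hull (\<phi> ` e) \<inter> convex hull {p, \<phi> a, \<phi> b} \<subseteq> convex hull (\<phi> ` (e \<inter> {a, b}))"
    unfolding eventually_nhds by blast
  have "card {\<phi> a, \<phi> b} \<le> DIM('b)"
    using dim card_insert_le_m1[of 2 "{\<phi> b}" "\<phi> a"] by simp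
  then have "interior (affine hull {\<phi> a, \<phi> b}) = {}"
    by (intro empty_interior_affine_hull) auto
  then have "\<not> U \<subseteq> affine hull {\<phi> a, \<phi> b}"
    using U interior_maximal by blast
  then obtain p where "p \<in> U" "p \<notin> affine hull {\<phi> a, \<phi> b}"
    by blast
  then show ?thesis
    using clear by (intro that)
qed

lemma straight_line_drawing_attach:
  fixes \<phi> :: "'a \<Rightarrow> 'b::euclidean_space"
  assumes dim: "2 \<le> DIM('b)" and \<phi>: "straight_line_drawing V F \<phi>"
    and ab: "{a, b} \<in> F" and v: "v \<notin> V"
  shows "\<exists>\<psi> :: 'a \<Rightarrow> 'b.
    straight_line_drawing (insert v V) (insert {v, a} (insert {v, b} F)) \<psi>"
proof -
  obtain p where p: "p \<notin> affine hull (\<phi> ` {a, b})"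
    and clear: "\<And>e. e \<in> graph_complex V F \<Longrightarrow>
      convex hull (\<phi> ` e) \<inter> convex hull (insert p (\<phi> ` {a, b})) \<subseteq> convex hull (\<phi> ` (e \<inter> {a, b}))"
    using exists_apex[OF dim \<phi> ab] by auto
  have "geometric_complex (graph_complex V F \<union> {{v}, {v, a}, {v, b}}) (\<phi>(v := p))"
  proof (rule geometric_complex_attach[where s = "{a, b}"])
    show "geometric_complex (graph_complex V F) \<phi>"
      using \<phi> by (simp add: straight_line_drawing_def)
    show "v \<notin> \<Union> (graph_complex V F)" "v \<notin> {a, b}"
      using v edge_subset ab by (auto simp: graph_complex_def)
    show "inj_on \<phi> {a, b}"
      by (rule inj_on_subset[OF straight_line_drawing_inj[OF \<phi>] edge_subset[OF ab]])
    show "p \<notin> \<phi> ` {a, b}"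
      using p hull_subset[of "\<phi> ` {a, b}" affine] by blast
    show "\<not> affine_dependent (insert p (\<phi> ` {a, b}))"
      using p by (intro affine_independent_insert) auto
  qed (use clear in auto)
  moreover have "graph_complex V F \<union> {{v}, {v, a}, {v, b}} =
      graph_complex (insert v V) (insert {v, a} (insert {v, b} F))"
    by (auto simp: graph_complex_def)
  ultimately show ?thesis
    unfolding straight_line_drawing_def by metis
qed

end

theorem two_tree_straight_line_drawing:
  assumes "2 \<le> DIM('b::euclidean_space)" "two_tree V F"
  shows "\<exists>\<phi> :: 'a \<Rightarrow> 'b. straight_line_drawing V F \<phi>"
  using assms(2)
proof (induction rule: two_tree.induct)
  case (edge a b)
  obtain i :: 'b where "i \<in> Basis"
    using nonempty_Basis by blast
  with edge have "geometric_complex (graph_complex {a, b} {{a, b}}) (\<lambda>x. if x = a then 0 else i)"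
    by (intro geometric_complex_simplex[of _ "{a, b}"]) (auto simp: inj_on_def graph_complex_def)
  then show ?case
    unfolding straight_line_drawing_def by blast
next
  case (attach V F a b v)
  from attach.IH obtain \<phi> :: "'a \<Rightarrow> 'b" where "straight_line_drawing V F \<phi>" by blast
  with attach.hyps show ?case
    by (intro simple_graph.straight_line_drawing_attach two_tree_simple_graph assms(1))
qed

section \<open>Planarity\<close>

definition undirected_edges :: "'a pair_pre_digraph \<Rightarrow> 'a set set" where
  "undirected_edges G = (\<lambda>(u, v). {u, v}) ` parcs G"

lemma (in simple_graph) straight_line_drawing_imp_planar:
  fixes \<phi> :: "'a \<Rightarrow> real^2" and G :: "'a pair_pre_digraph"
  assumes \<phi>: "straight_line_drawing V F \<phi>" and G: "pverts G = V" "undirected_edges G \<subseteq> F"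
  shows "planar G"
proof -
  have in_F: "{u, v} \<in> F" if "(u, v) \<in> parcs G" for u v
    using that G(2) by (force simp: undirected_edges_def)
  have "\<exists>g. arc g \<and> {pathstart g, pathfinish g} = \<phi> ` e \<and> path_image g = convex hull (\<phi> ` e)"
    if e: "e \<in> F" for e
  proof -
    obtain a b where ab: "e = {a, b}" "a \<noteq> b" "a \<in> V" "b \<in> V"
      using e by (rule edgeE)
    then have "arc (linepath (\<phi> a) (\<phi> b))"
      using straight_line_drawing_inj[OF \<phi>] by (intro arc_linepath) (auto simp: inj_on_def)
    then show ?thesis
      by (intro exI[of _ "linepath (\<phi> a) (\<phi> b)"]) (simp add: ab(1) segment_convex_hull)
  qed
  then obtain \<gamma> where \<gamma>: "\<And>e. e \<in> F \<Longrightarrow> arc (\<gamma> e)"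
      "\<And>e. e \<in> F \<Longrightarrow> {pathstart (\<gamma> e), pathfinish (\<gamma> e)} = \<phi> ` e"
      "\<And>e. e \<in> F \<Longrightarrow> path_image (\<gamma> e) = convex hull (\<phi> ` e)"
    by metis
  have curves: "arc (\<gamma> {u, v}) \<and> {pathstart (\<gamma> {u, v}), pathfinish (\<gamma> {u, v})} = {\<phi> u, \<phi> v} \<and>
      path_image (\<gamma> {u, v}) \<inter> \<phi> ` V = {\<phi> u, \<phi> v}" if "(u, v) \<in> parcs G" for u v
    using \<gamma>[OF in_F[OF that]] straight_line_drawing_Int_vertices[OF \<phi> in_F[OF that]] by simp
  have crossings: "path_image (\<gamma> {u, v}) \<inter> path_image (\<gamma> {x, y}) \<subseteq> \<phi> ` ({u, v} \<inter> {x, y})"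
    if "(u, v) \<in> parcs G" "(x, y) \<in> parcs G" "{u, v} \<noteq> {x, y}" for u v x y
    using straight_line_drawing_Int_edges[OF \<phi> in_F in_F] that
    unfolding \<gamma>(3)[OF in_F[OF that(1)]] \<gamma>(3)[OF in_F[OF that(2)]] by blast
  have "plane_embedding G \<phi> \<gamma>"
    unfolding plane_embedding_def G(1)
    by (intro conjI ballI case_prodI2 impI)
      (simp_all only: curves crossings straight_line_drawing_inj[OF \<phi>] simp_thms)
  then show ?thesis
    unfolding planar_def by blast
qed

lemma pcas_vwalk_arcs: "pcas x (vwalk_arcs (x # xs)) (last (x # xs))"
  by (induction xs arbitrary: x) auto

lemma pawalk_verts_vwalk_arcs: "pawalk_verts x (vwalk_arcs (x # xs)) = x # xs"
  by (induction xs arbitrary: x) auto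

context pair_graph
begin

lemma in_undirected_edges_iff: "{u, v} \<in> undirected_edges G \<longleftrightarrow> (u, v) \<in> parcs G"
  using arcs_symmetric by (force simp: undirected_edges_def doubleton_eq_iff)

lemma simple_graph_undirected_edges: "simple_graph (pverts G) (undirected_edges G)"
  using in_arcsD1 in_arcsD2 no_loops' by unfold_locales (auto simp: undirected_edges_def)

lemma vertex_cycle_imp_undirected_cycle:
  assumes "vertex_cycle (undirected_edges G) xs"
  shows "undirected_cycle G (vwalk_arcs (xs @ [hd xs]))"
proof -
  obtain x ys where xs: "xs = x # ys"
    using assms by (cases xs) (auto simp: vertex_cycle_def)
  let ?p = "vwalk_arcs (x # ys @ [x])"
  have "set (walk_edges (x # ys @ [x])) \<subseteq> undirected_edges G"
    using assms by (simp add: vertex_cycle_def cycle_edges_def xs)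
  then have arcs: "set ?p \<subseteq> parcs G"
    by (auto simp: walk_edges_def in_undirected_edges_iff)
  have p: "?p \<noteq> []"
    by (cases ys) auto
  then have "x \<in> pverts G"
    using arcs in_arcsD1 by (cases ys) auto
  moreover have "pcas x ?p x"
    using pcas_vwalk_arcs[of x "ys @ [x]"] by simp
  moreover have "distinct (tl (pawalk_verts x ?p))"
    using assms by (simp add: pawalk_verts_vwalk_arcs vertex_cycle_def xs del: vwalk_arcs_Cons)
  ultimately have "cycle ?p"
    using arcs p unfolding cycle_def awalk_def by blast
  moreover have "length ?p = length xs"
    using vwalk_length_simp[of "x # ys @ [x]"] unfolding vwalk_length_def by (simp only: xs) simp
  then have "3 \<le> length ?p"
    using assms by (simp add: vertex_cycle_def)
  ultimately show ?thesis
    by (simp add: undirected_cycle_def xs)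
qed

end

lemma mod4_weighted_graph_undirected_edges:
  assumes "pair_graph G"
    and mod4: "\<And>p. undirected_cycle G p \<Longrightarrow> length p mod 4 = 1 \<or> length p mod 4 = 2"
  shows "mod4_weighted_graph (pverts G) (undirected_edges G) (\<lambda>_. 1)"
proof -
  interpret pair_graph G by fact
  interpret simple_graph "pverts G" "undirected_edges G"
    by (rule simple_graph_undirected_edges)
  show ?thesis
  proof
    fix xs
    assume xs: "vertex_cycle (undirected_edges G) xs"
    have "cycle_weight (\<lambda>_. 1 :: nat) xs = length (vwalk_arcs (xs @ [hd xs]))"
      by (simp add: cycle_weight_def cycle_edges_def walk_edges_def sum_list_triv)
    then show "cycle_weight (\<lambda>_. 1 :: nat) xs mod 4 \<in> {1, 2}"
      using mod4[OF vertex_cycle_imp_undirected_cycle[OF xs]] by auto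
  qed
qed

lemma (in pair_graph) two_le_card_verts_if_undirected_cycle:
  assumes "undirected_cycle G p"
  shows "2 \<le> card (pverts G)"
proof -
  obtain u v where uv: "(u, v) \<in> parcs G"
    using assms by (cases p) (auto simp: undirected_cycle_def cycle_def awalk_def)
  then have "card {u, v} \<le> card (pverts G)"
    using in_arcsD1 in_arcsD2 by (intro card_mono) auto
  then show ?thesis
    using no_loops'[OF uv] by simp
qed

theorem mainTheorem15:
  fixes G :: "'a pair_pre_digraph"
  assumes "G \<in> eps12"
  shows "planar G"
proof -
  have G: "pair_graph G"
    and mod4: "\<And>p. undirected_cycle G p \<Longrightarrow> length p mod 4 = 1 \<or> length p mod 4 = 2"
    using assms by (auto simp: eps12_def Euler_graph_def)
  have "2 \<le> card (pverts G)"
    using assms pair_graph.two_le_card_verts_if_undirected_cycle[OF G] by (auto simp: eps12_def)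
  with mod4_weighted_graph_undirected_edges[OF G mod4]
  obtain T where T: "two_tree (pverts G) T" "undirected_edges G \<subseteq> T"
    using mod4_weighted_graph_subset_two_tree by metis
  obtain \<phi> :: "'a \<Rightarrow> real^2" where "straight_line_drawing (pverts G) T \<phi>"
    using two_tree_straight_line_drawing[OF _ T(1), where 'b = "real^2"] by auto
  then show ?thesis
    using simple_graph.straight_line_drawing_imp_planar[OF two_tree_simple_graph[OF T(1)]] T(2)
    by blast
qed

end
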